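(* Let $d\geq 1$ and $n\geq 1$. The sequence of polynomials $(Q_{d,n,j}(t))_{j\in\{\infty,1,2,\dotsc,d\}}$ (in the order $\infty,1,2,\dotsc,d$) forms an interlacing sequence. Moreover, the polynomials $Q_{d,n}(t)=Q_{d,n+1,\infty}(t)$ have only real zeros.
   Context: An anchor word is a word $a_1,a_2,\dots,a_n$ in the alphabet $\{1,2,\dots,d,\infty\}$ such that $a_n=\infty$ and, for all $i=1,\dots,n-1$, $a_i\neq\infty$ implies $a_{i+1}\geq a_i+1$. Let $\mathcal{A}(d,n)$ be the set of such anchor words, and for a word $w$ let $\mathrm{bigtiles}(w)$ be the number of entries of $w$ that are integers (not $\infty$). Define $Q_{d,n}(t)=\sum_{w\in\mathcal{A}(d,n)} t^{\mathrm{bigtiles}(w)}$ and, for $j\in\{1,\dots,d,\infty\}$, the refined polynomials $Q_{d,n,j}(t)=\sum_{w\in\mathcal{A}(d,n),\, w_n=j} t^{\mathrm{bigtiles}(w)}$ (here the last-letter condition $a_n=\infty$ is relaxed so that words ending in $j$ are allowed). They satisfy $Q_{d,1,\infty}=1$, $Q_{d,1,j}=t$ for $j<\infty$, and $Q_{d,n,\infty}=Q_{d,n-1,\infty}+\sum_{k=1}^d Q_{d,n-1,k}$, $Q_{d,n,j}=t\,Q_{d,n-1,\infty}+t\sum_{k=1}^{j-1}Q_{d,n-1,k}$ for $j<\infty$; i.e. the vector $(Q_{d,n,\infty},Q_{d,n,1},\dots,Q_{d,n,d})^T$ is obtained from the one at $n-1$ by the matrix whose first row is all ones and whose row for $j$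 is $(t,t,\dots,t,0,\dots,0)$ with $t$ in the first $j$ positions. Interlacing: for real-rooted $f,g$ with positive leading coefficients and zeros $f_i$, $g_i$, $f$ interlaces $g$ if $\deg f+1=\deg g=d'$ and $g_1\leq f_1\leq g_2\leq\cdots\leq f_{d'-1}\leq g_{d'}$; $f$ alternates left of $g$ if $\deg f=\deg g=d'$ and $f_1\leq g_1\leq f_2\leq\cdots\leq f_{d'}\leq g_{d'}$; $f\ll g$ means one of these holds (with conventions $0\ll 0$, $0\ll h$, $h\ll 0$). A sequence $(f_i)$ of real-rooted polynomials is interlacing if $f_i\ll f_j$ for all $i<j$.
   Formalization: The printed identity Q_{d,n}=Q_{d,n+1,∞} fails under the given definitions (for d=n=1 it reads 1=1+t); it is replaced by Q_{d,n}=Q_{d,n,∞}, and real-rootedness is stated for both Q_{d,n} and Q_{d,n+1,∞}. *)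

theory Defs
  imports
    Complex_Main
    "HOL-Library.Extended_Nat"
    "HOL-Library.Multiset"
    "HOL-Computational_Algebra.Polynomial"
begin

section \<open>Anchor words\<close>

definition letters :: "nat \<Rightarrow> enat set" where
  "letters d = insert \<infinity> (enat ` {1..d})"

text \<open>
  Words satisfying the successor condition of anchor words, with no condition on the last letter.
  Lists are indexed from 0, so \<open>w ! i\<close> is the letter \<open>a\<^sub>i\<^sub>+\<^sub>1\<close>. In the type of extended naturals
  \<open>\<infinity>\<close> lies above every integer, so an integer letter may always be followed by \<open>\<infinity>\<close>.
\<close>

definition relaxed_words :: "nat \<Rightarrow> nat \<Rightarrow> enat list set" where
  "relaxed_words d n =
     {w. length w = n \<and> set w \<subseteq> letters d \<and>
         (\<forall>i. Suc i < n \<longrightarrow> w ! i \<noteq> \<infinity> \<longrightarrow> w ! Suc i \<ge> w ! i + 1)}"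

definition anchor_words :: "nat \<Rightarrow> nat \<Rightarrow> enat list set" where
  "anchor_words d n = {w \<in> relaxed_words d n. w \<noteq> [] \<and> last w = \<infinity>}"

definition bigtiles :: "enat list \<Rightarrow> nat" where
  "bigtiles w = length (filter (\<lambda>a. a \<noteq> \<infinity>) w)"

definition Q :: "nat \<Rightarrow> nat \<Rightarrow> real poly" where
  "Q d n = (\<Sum>w\<in>anchor_words d n. monom 1 (bigtiles w))"

definition Q_ref :: "nat \<Rightarrow> nat \<Rightarrow> enat \<Rightarrow> real poly" where
  "Q_ref d n j = (\<Sum>w\<in>{w \<in> relaxed_words d n. w \<noteq> [] \<and> last w = j}. monom 1 (bigtiles w))"

section \<open>Real-rootedness and interlacing\<close>

text \<open>
  With this definition the zero polynomial is not real-rooted; it is admitted explicitly where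
  the conventions for \<open>0\<close> require it. Nonzero constants are real-rooted.
\<close>

definition real_rooted :: "real poly \<Rightarrow> bool" where
  "real_rooted p \<longleftrightarrow> (\<forall>z::complex. poly (map_poly complex_of_real p) z = 0 \<longrightarrow> z \<in> \<real>)"

text \<open>Zeros are listed in increasing order, with multiplicity.\<close>

definition zeros :: "real poly \<Rightarrow> real list" where
  "zeros p = sorted_list_of_multiset (proots p)"

definition standard :: "real poly \<Rightarrow> bool" where
  "standard p \<longleftrightarrow> real_rooted p \<and> lead_coeff p > 0"

definition interlaces :: "real poly \<Rightarrow> real poly \<Rightarrow> bool" where
  "interlaces f g \<longleftrightarrow>
     standard f \<and> standard g \<and> degree f + 1 = degree g \<and>
     (\<forall>i < degree f. zeros g ! i \<le> zeros f ! i \<and> zeros f ! i \<le> zeros g ! Suc i)"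

definition alternates_left :: "real poly \<Rightarrow> real poly \<Rightarrow> bool" where
  "alternates_left f g \<longleftrightarrow>
     standard f \<and> standard g \<and> degree f = degree g \<and>
     (\<forall>i < degree f. zeros f ! i \<le> zeros g ! i) \<and>
     (\<forall>i. Suc i < degree f \<longrightarrow> zeros g ! i \<le> zeros f ! Suc i)"

definition il_le :: "real poly \<Rightarrow> real poly \<Rightarrow> bool" (infix \<open>\<lless>\<close> 50) where
  "f \<lless> g \<longleftrightarrow>
     interlaces f g \<or> alternates_left f g \<or>
     (f = 0 \<and> (g = 0 \<or> standard g)) \<or> (g = 0 \<and> standard f)"

definition interlacing_seq :: "real poly list \<Rightarrow> bool" where
  "interlacing_seq fs \<longleftrightarrow>
     (\<forall>f\<in>set fs. f = 0 \<or> real_rooted f) \<and>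
     (\<forall>i j. i < j \<longrightarrow> j < length fs \<longrightarrow> fs ! i \<lless> fs ! j)"

end

theory Submission
  imports
    Defs
    "HOL-Computational_Algebra.Fundamental_Theorem_Algebra"
    "HOL-Real_Asymp.Real_Asymp"
begin

text \<open>
  For real-rooted \<open>f\<close> and \<open>g\<close> with positive leading coefficients, \<open>f \<lless> g\<close> holds as soon as
  \<open>g(z)\<close> times the conjugate of \<open>f(z)\<close> lies, for all \<open>z\<close> in the upper half-plane, in the convex
  cone of numbers with argument in \<open>[0, \<pi>)\<close>: the difference of the arguments of \<open>g\<close> and \<open>f\<close>
  stays in \<open>[0, \<pi>]\<close>, and near a real point \<open>x\<close> it tends to \<open>\<pi>\<close> times the difference of the numbers
  of zeros above \<open>x\<close>, which is therefore 0 or 1. The cone condition is additive in \<open>f\<close> and in \<open>g\<close>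
  and forbids zeros off the real axis, so it passes through the recurrence, in which every new
  polynomial is a partial sum \<open>S\<^sub>j\<close> of the old ones, multiplied by \<open>t\<close> except for the letter \<open>\<infinity>\<close>.
\<close>

section \<open>Real polynomials at complex arguments\<close>

definition cpoly :: "real poly \<Rightarrow> complex \<Rightarrow> complex" where
  "cpoly p z = poly (map_poly complex_of_real p) z"

lemma cpoly_0 [simp]: "cpoly 0 z = 0"
  by (simp add: cpoly_def)

lemma cpoly_pCons [simp]: "cpoly (pCons a p) z = of_real a + z * cpoly p z"
  by (simp add: cpoly_def map_poly_pCons)

lemma cpoly_add [simp]: "cpoly (p + q) z = cpoly p z + cpoly q z"
  by (induction p q rule: poly_induct2) (auto simp: algebra_simps)

lemma cpoly_smult [simp]: "cpoly (smult c p) z = of_real c * cpoly p z"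
  by (induction p) (auto simp: algebra_simps)

lemma cpoly_mult [simp]: "cpoly (p * q) z = cpoly p z * cpoly q z"
  by (induction p) (auto simp: algebra_simps)

lemma cpoly_sum: "cpoly (\<Sum>i\<in>A. f i) z = (\<Sum>i\<in>A. cpoly (f i) z)"
  by (induction A rule: infinite_finite_induct) auto

lemma cpoly_cnj: "cpoly p (cnj z) = cnj (cpoly p z)"
  by (induction p) auto

lemma cpoly_of_real: "cpoly p (of_real x) = of_real (poly p x)"
  by (induction p) auto

text \<open>Nonreal zeros of a real polynomial come in conjugate pairs, so one open half-plane
  detects them all.\<close>

lemma real_rooted_iff_upper:
  "real_rooted p \<longleftrightarrow> (\<forall>z. Im z > 0 \<longrightarrow> cpoly p z \<noteq> 0)"
proof
  assume "real_rooted p"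
  then show "\<forall>z. Im z > 0 \<longrightarrow> cpoly p z \<noteq> 0"
    by (auto simp: real_rooted_def cpoly_def complex_is_Real_iff)
next
  assume *: "\<forall>z. Im z > 0 \<longrightarrow> cpoly p z \<noteq> 0"
  have "z \<in> \<real>" if "cpoly p z = 0" for z
  proof (rule ccontr)
    assume "z \<notin> \<real>"
    then have "Im z > 0 \<or> Im (cnj z) > 0"
      by (auto simp: complex_is_Real_iff)
    then show False
      using * that by (auto simp: cpoly_cnj dest: spec[of _ "cnj z"])
  qed
  then show "real_rooted p"
    by (simp add: real_rooted_def cpoly_def)
qed

text \<open>By induction on the degree: some complex zero exists, it is real by assumption, and the
  cofactor of its linear factor inherits real-rootedness because each of its zeros is a zero of
  \<open>p\<close>.\<close>

lemma real_rooted_factor: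
  assumes "real_rooted p"
  shows "p = smult (lead_coeff p) (\<Prod>a\<in>#proots p. [:- a, 1:]) \<and> size (proots p) = degree p"
  using assms
proof (induction "degree p" arbitrary: p)
  case 0
  then obtain c where "p = [:c:]"
    by (metis degree_eq_zeroE)
  then show ?case by simp
next
  case (Suc n)
  have "degree (map_poly complex_of_real p) = degree p"
    by (rule degree_map_poly) auto
  then have "\<not> constant (poly (map_poly complex_of_real p))"
    using Suc.hyps(2) by (simp add: constant_degree)
  then obtain z where z: "cpoly p z = 0"
    using fundamental_theorem_of_algebra unfolding cpoly_def by blast
  then have "z \<in> \<real>"
    using Suc.prems by (simp add: real_rooted_def cpoly_def)
  then obtain a where "z = of_real a"
    by (auto elim: Reals_cases)
  then have "poly p a = 0"
    using z by (simp add: cpoly_of_real)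
  then obtain q where q: "p = [:- a, 1:] * q"
    by (meson poly_eq_0_iff_dvd dvdE)
  have "q \<noteq> 0"
    using Suc.hyps(2) q by auto
  then have deg: "degree p = Suc (degree q)"
    unfolding q by (subst degree_mult_eq) auto
  have lc: "lead_coeff p = lead_coeff q"
    unfolding q by (simp only: lead_coeff_mult) simp
  have roots: "proots p = add_mset a (proots q)"
    unfolding q using \<open>q \<noteq> 0\<close> by (subst proots_mult) auto
  have "real_rooted q"
    using Suc.prems by (auto simp: real_rooted_iff_upper q simp del: mult_pCons_left)
  then have IH: "q = smult (lead_coeff q) (\<Prod>a\<in>#proots q. [:- a, 1:])"
      "size (proots q) = degree q"
    using Suc.hyps deg by auto
  have "smult (lead_coeff p) (\<Prod>a\<in>#proots p. [:- a, 1:]) =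
      [:- a, 1:] * smult (lead_coeff q) (\<Prod>a\<in>#proots q. [:- a, 1:])"
    by (simp only: lc roots mult_smult_right image_mset_add_mset prod_mset.add_mset)
  also have "\<dots> = p"
    by (simp only: IH(1)[symmetric] q[symmetric])
  finally show ?case
    using IH(2) deg roots by simp
qed

section \<open>Angles subtended by the zeros\<close>

text \<open>For \<open>y > 0\<close> this is the argument in \<open>(0, \<pi>)\<close> of \<open>x + \<i> y - a\<close>.\<close>

definition angle :: "real \<Rightarrow> real \<Rightarrow> real \<Rightarrow> real" where
  "angle x y a = pi / 2 - arctan ((x - a) / y)"

text \<open>With \<open>u = (x - a) / y\<close> the modulus is
  \<open>y * sqrt (1 + u\<^sup>2)\<close>, and \<pi>/2 - arctan u has cosine
  \<open>u / sqrt (1 + u\<^sup>2)\<close> and sine \<open>1 / sqrt (1 + u\<^sup>2)\<close>.\<close>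

lemma polar_angle:
  assumes "y > 0"
  shows "\<exists>r>0. Complex x y - of_real a = of_real r * cis (angle x y a)"
proof -
  define u where "u = (x - a) / y"
  have pos: "sqrt (1 + u\<^sup>2) > 0"
    by (simp add: add_pos_nonneg)
  have "Complex x y - of_real a = of_real (y * sqrt (1 + u\<^sup>2)) * cis (angle x y a)"
    using assms pos
    by (auto simp: complex_eq_iff angle_def cos_diff sin_diff sin_arctan cos_arctan
        simp flip: u_def) (simp add: u_def)
  then show ?thesis
    using assms pos by (intro exI[of _ "y * sqrt (1 + u\<^sup>2)"]) auto
qed

text \<open>For standard \<open>p\<close> and \<open>y > 0\<close> this is a branch of the argument
  of \<open>p\<close> at \<open>Complex x y\<close>, continuous in \<open>x\<close> and not reduced
  modulo 2\<pi>, so that zeros can be counted by it.\<close>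

definition total_angle :: "real \<Rightarrow> real \<Rightarrow> real poly \<Rightarrow> real" where
  "total_angle x y p = (\<Sum>a\<in>#proots p. angle x y a)"

lemma polar_prod_linear:
  assumes "y > 0"
  shows "\<exists>r>0. cpoly (\<Prod>a\<in>#A. [:- a, 1:]) (Complex x y) =
    of_real r * cis (\<Sum>a\<in>#A. angle x y a)"
proof (induction A)
  case empty
  show ?case
    by (auto simp: one_pCons intro!: exI[of _ "1::real"])
next
  case (add a A)
  obtain r where r: "r > 0" "cpoly (\<Prod>a\<in>#A. [:- a, 1:]) (Complex x y) =
      of_real r * cis (\<Sum>a\<in>#A. angle x y a)"
    using add by blast
  obtain s where s: "s > 0" "Complex x y - of_real a = of_real s * cis (angle x y a)"
    using polar_angle[OF assms] by blast
  have "cpoly (\<Prod>a\<in>#add_mset a A. [:- a, 1:]) (Complex x y) =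
      (Complex x y - of_real a) * cpoly (\<Prod>a\<in>#A. [:- a, 1:]) (Complex x y)"
    by (simp del: mult_pCons_left)
  also have "\<dots> = of_real (s * r) * cis (\<Sum>a\<in>#add_mset a A. angle x y a)"
    unfolding r s by (simp add: cis_mult[symmetric])
  finally show ?case
    using r(1) s(1) by (intro exI[of _ "s * r"]) auto
qed

lemma polar_cpoly:
  assumes "standard p" and "y > 0"
  shows "\<exists>r>0. cpoly p (Complex x y) = of_real r * cis (total_angle x y p)"
proof -
  obtain r where r: "r > 0" "cpoly (\<Prod>a\<in>#proots p. [:- a, 1:]) (Complex x y) =
      of_real r * cis (\<Sum>a\<in>#proots p. angle x y a)"
    using polar_prod_linear[OF assms(2)] by blast
  have "p = smult (lead_coeff p) (\<Prod>a\<in>#proots p. [:- a, 1:])"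
    using assms(1) real_rooted_factor by (simp add: standard_def)
  from arg_cong[OF this, of "\<lambda>q. cpoly q (Complex x y)"]
  have "cpoly p (Complex x y) = of_real (lead_coeff p * r) * cis (total_angle x y p)"
    by (simp only: cpoly_smult r(2) total_angle_def of_real_mult mult.assoc)
  then show ?thesis
    using r(1) assms(1) by (intro exI[of _ "lead_coeff p * r"]) (auto simp: standard_def)
qed

lemma continuous_on_total_angle:
  "continuous_on A (\<lambda>x. total_angle x y p)"
proof -
  have "continuous_on A (\<lambda>x. angle x y a)" for a
    unfolding angle_def divide_inverse
    by (intro continuous_on_diff continuous_on_const continuous_on_arctan continuous_on_mult
        continuous_on_id)
  then have "continuous_on A (\<lambda>x. \<Sum>a\<in>#M. angle x y a)" for M
    by (induction M) (simp_all add: continuous_on_add)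
  then show ?thesis
    by (simp add: total_angle_def)
qed

text \<open>Fixes the branch: the difference of two total angles, which the values of the
  polynomials determine only modulo 2\<pi>, is normalised to 0 far to the right.\<close>

lemma total_angle_at_top:
  assumes "y > 0"
  shows "((\<lambda>x. total_angle x y p) \<longlongrightarrow> 0) at_top"
proof -
  have "((\<lambda>x. angle x y a) \<longlongrightarrow> 0) at_top" for a
    unfolding angle_def using assms by real_asymp
  then have "((\<lambda>x. \<Sum>a\<in>#M. angle x y a) \<longlongrightarrow> 0) at_top" for M
  proof (induction M)
    case (add a M)
    then show ?case
      using tendsto_add[of "\<lambda>x. angle x y a" 0 at_top "\<lambda>x. \<Sum>a\<in>#M. angle x y a" 0] by simp
  qed simp
  then show ?thesis
    by (simp add: total_angle_def)
qed

definition zeros_above :: "real \<Rightarrow> real poly \<Rightarrow> nat" where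
  "zeros_above x p = size (filter_mset (\<lambda>a. x < a) (proots p))"

text \<open>
  The point \<open>x + 1/t + \<i>/t\<^sup>2\<close> approaches \<open>x\<close> tangentially from the right, so that a zero at \<open>x\<close>
  itself contributes the angle 0 in the limit.
\<close>

lemma total_angle_boundary:
  "((\<lambda>t. total_angle (x + 1 / t) (1 / t\<^sup>2) p) \<longlongrightarrow> pi * real (zeros_above x p)) at_top"
proof -
  have single: "((\<lambda>t. angle (x + 1 / t) (1 / t\<^sup>2) a) \<longlongrightarrow> (if x < a then pi else 0)) at_top" for a
  proof (cases "x < a")
    case True
    then have "filterlim (\<lambda>t. (x + 1 / t - a) / (1 / t\<^sup>2)) at_bot at_top"
      by real_asymp
    then have "((\<lambda>t. arctan ((x + 1 / t - a) / (1 / t\<^sup>2))) \<longlongrightarrow> - (pi / 2)) at_top"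
      by (rule filterlim_compose[OF tendsto_arctan_at_bot])
    from tendsto_diff[OF tendsto_const[of "pi / 2"] this] show ?thesis
      using True by (simp add: angle_def)
  next
    case False
    have "filterlim (\<lambda>t. (x + 1 / t - a) / (1 / t\<^sup>2)) at_top at_top"
    proof (cases "x = a")
      case True
      \<comment> \<open>For \<open>x = a\<close> the quotient is just \<open>t\<close>: the height
        is the square of the horizontal offset.\<close>
      then show ?thesis by simp real_asymp
    next
      case False
      then have "x > a" using \<open>\<not> x < a\<close> by simp
      then show ?thesis by real_asymp
    qed
    then have "((\<lambda>t. arctan ((x + 1 / t - a) / (1 / t\<^sup>2))) \<longlongrightarrow> pi / 2) at_top"
      by (rule filterlim_compose[OF tendsto_arctan_at_top])
    from tendsto_diff[OF tendsto_const[of "pi / 2"] this] show ?thesis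
      using False by (simp add: angle_def)
  qed
  have "((\<lambda>t. \<Sum>a\<in>#M. angle (x + 1 / t) (1 / t\<^sup>2) a) \<longlongrightarrow>
      pi * real (size (filter_mset (\<lambda>a. x < a) M))) at_top" for M
  proof (induction M)
    case (add a M)
    from tendsto_add[OF single[of a] add] show ?case
      by (auto simp: algebra_simps split: if_splits)
  qed simp
  then show ?thesis
    by (simp add: total_angle_def zeros_above_def)
qed

section \<open>Half-plane characterisation of interlacing\<close>

text \<open>
  A convex cone missing 0: a polynomial whose product with the conjugate of another one lies in
  this cone on the whole upper half-plane has no zero there.
\<close>

definition half_cone :: "complex set" where
  "half_cone = {w. Im w > 0 \<or> Im w = 0 \<and> Re w > 0}"

lemma half_cone_add: "v \<in> half_cone \<Longrightarrow> w \<in> half_cone \<Longrightarrow> v + w \<in> half_cone"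
  by (auto simp: half_cone_def)

lemma half_cone_sum:
  "finite A \<Longrightarrow> A \<noteq> {} \<Longrightarrow> (\<And>i. i \<in> A \<Longrightarrow> f i \<in> half_cone) \<Longrightarrow> sum f A \<in> half_cone"
  by (induction A rule: finite_ne_induct) (auto intro: half_cone_add)

lemma half_cone_scale: "r > 0 \<Longrightarrow> of_real r * w \<in> half_cone \<longleftrightarrow> w \<in> half_cone"
  by (auto simp: half_cone_def zero_less_mult_iff)

text \<open>The product has the argument of \<open>g\<close> minus that of \<open>f\<close>. Unlike
  the quotient \<open>g / f\<close>, it is additive in \<open>f\<close> as well as in
  \<open>g\<close>.\<close>

definition arg_le :: "real poly \<Rightarrow> real poly \<Rightarrow> bool" where
  "arg_le f g \<longleftrightarrow> (\<forall>z. Im z > 0 \<longrightarrow> cpoly g z * cnj (cpoly f z) \<in> half_cone)"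

section \<open>Closure properties of the cone relation\<close>

lemma arg_le_sum_left:
  assumes "finite A" "A \<noteq> {}" "\<And>i. i \<in> A \<Longrightarrow> arg_le (f i) g"
  shows "arg_le (\<Sum>i\<in>A. f i) g"
  using assms
  by (auto simp: arg_le_def cpoly_sum cnj_sum sum_distrib_left intro!: half_cone_sum)

lemma arg_le_add_right: "arg_le f g \<Longrightarrow> arg_le f h \<Longrightarrow> arg_le f (g + h)"
  by (auto simp: arg_le_def distrib_right intro!: half_cone_add)

lemma arg_le_add_left: "arg_le f h \<Longrightarrow> arg_le g h \<Longrightarrow> arg_le (f + g) h"
  by (auto simp: arg_le_def distrib_left intro!: half_cone_add)

lemma arg_le_nonzero:
  assumes "arg_le f g" "Im z > 0"
  shows "cpoly f z \<noteq> 0" "cpoly g z \<noteq> 0"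
  using assms by (auto simp: arg_le_def half_cone_def)

lemma arg_le_real_rooted:
  assumes "arg_le f g"
  shows "real_rooted f" "real_rooted g"
  using arg_le_nonzero[OF assms] by (auto simp: real_rooted_iff_upper)

text \<open>The product is a squared modulus, hence a positive real; \<open>half_cone\<close>
  contains the positive real ray for this purpose.\<close>

lemma arg_le_refl: "real_rooted f \<Longrightarrow> arg_le f f"
  by (auto simp: arg_le_def real_rooted_iff_upper complex_norm_square[symmetric] half_cone_def)

text \<open>The product is a positive multiple of \<open>z\<close>, which lies in the upper
  half-plane itself.\<close>

lemma arg_le_X_mult:
  assumes "real_rooted f"
  shows "arg_le f ([:0, 1:] * f)"
  unfolding arg_le_def
proof (intro allI impI)
  fix z :: complex
  assume z: "Im z > 0"
  then have nz: "cpoly f z \<noteq> 0"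
    using assms by (simp add: real_rooted_iff_upper)
  have "cpoly ([:0, 1:] * f) z * cnj (cpoly f z) = of_real ((cmod (cpoly f z))\<^sup>2) * z"
    by (simp add: mult.assoc complex_norm_square[symmetric] del: of_real_power)
  moreover have "z \<in> half_cone"
    using z by (simp add: half_cone_def)
  moreover have "(cmod (cpoly f z))\<^sup>2 > 0"
    using nz by simp
  ultimately show "cpoly ([:0, 1:] * f) z * cnj (cpoly f z) \<in> half_cone"
    by (simp only: half_cone_scale)
qed

lemma arg_le_X_mult_both:
  assumes "arg_le f g"
  shows "arg_le ([:0, 1:] * f) ([:0, 1:] * g)"
  unfolding arg_le_def
proof (intro allI impI)
  fix z :: complex
  assume z: "Im z > 0"
  then have "z \<noteq> 0" by auto
  have "cpoly ([:0, 1:] * g) z * cnj (cpoly ([:0, 1:] * f) z) =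
      (z * cnj z) * (cpoly g z * cnj (cpoly f z))"
    by simp
  also have "\<dots> = of_real ((cmod z)\<^sup>2) * (cpoly g z * cnj (cpoly f z))"
    by (simp only: complex_norm_square[symmetric])
  finally have "cpoly ([:0, 1:] * g) z * cnj (cpoly ([:0, 1:] * f) z) =
      of_real ((cmod z)\<^sup>2) * (cpoly g z * cnj (cpoly f z))" .
  moreover have "(cmod z)\<^sup>2 > 0"
    using \<open>z \<noteq> 0\<close> by simp
  moreover have "cpoly g z * cnj (cpoly f z) \<in> half_cone"
    using assms z by (simp add: arg_le_def)
  ultimately show "cpoly ([:0, 1:] * g) z * cnj (cpoly ([:0, 1:] * f) z) \<in> half_cone"
    by (simp only: half_cone_scale)
qed

text \<open>
  The sine of the angle difference is nonnegative, so the difference never crosses \<open>-\<pi>/2\<close> or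
  \<open>3\<pi>/2\<close>; it tends to 0 as \<open>x\<close> grows, hence stays in \<open>[0, \<pi>]\<close>.
\<close>

lemma arg_le_total_angle:
  assumes "arg_le f g" "standard f" "standard g" "y > 0"
  shows "total_angle x y g - total_angle x y f \<in> {0..pi}"
proof -
  define D where "D x = total_angle x y g - total_angle x y f" for x
  have sin_nonneg: "sin (D x) \<ge> 0" for x
  proof -
    obtain r where r: "r > 0" "cpoly f (Complex x y) = of_real r * cis (total_angle x y f)"
      using polar_cpoly assms by blast
    obtain s where s: "s > 0" "cpoly g (Complex x y) = of_real s * cis (total_angle x y g)"
      using polar_cpoly assms by blast
    have "cpoly g (Complex x y) * cnj (cpoly f (Complex x y)) =
        of_real (s * r) * (cis (total_angle x y g) * cis (- total_angle x y f))"
      unfolding r s by (simp add: cis_cnj)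
    also have "\<dots> = of_real (s * r) * cis (D x)"
      by (simp only: cis_mult) (simp add: D_def)
    finally have "of_real (s * r) * cis (D x) \<in> half_cone"
      using assms(1,4) by (metis arg_le_def complex.sel(2))
    then have "cis (D x) \<in> half_cone"
      using r(1) s(1) half_cone_scale[of "s * r" "cis (D x)"] by simp
    then show ?thesis
      by (auto simp: half_cone_def)
  qed
  have cont: "continuous_on A D" for A
    unfolding D_def by (intro continuous_intros continuous_on_total_angle)
  have lim: "(D \<longlongrightarrow> 0) at_top"
    using tendsto_diff[OF total_angle_at_top[OF assms(4), of g] total_angle_at_top[OF assms(4), of f]]
    by (simp add: D_def[abs_def])
  have "eventually (\<lambda>x'. x' \<ge> x \<and> dist (D x') 0 < pi / 2) at_top"
    using tendstoD[OF lim, of "pi / 2"] by (intro eventually_conj eventually_ge_at_top) auto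
  then obtain b where b: "x \<le> b" "\<bar>D b\<bar> < pi / 2"
    by (auto simp: eventually_at_top_linorder)
  have Db: "- (pi / 2) \<le> D b" "D b \<le> 3 * pi / 2"
    using b(2) by linarith+
  have lower: "D x > - (pi / 2)"
  proof (rule ccontr)
    assume "\<not> D x > - (pi / 2)"
    then obtain c where "D c = - (pi / 2)"
      using IVT'[of D x "- (pi / 2)" b] b(1) Db cont by auto
    then show False
      using sin_nonneg[of c] by simp
  qed
  have upper: "D x < 3 * pi / 2"
  proof (rule ccontr)
    assume "\<not> D x < 3 * pi / 2"
    then obtain c where c: "D c = 3 * pi / 2"
      using IVT2'[of D b "3 * pi / 2" x] b(1) Db cont by auto
    have "sin (3 * pi / 2) = - 1"
      using sin_3over2_pi by simp
    then show False
      using sin_nonneg[of c] c by simp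
  qed
  \<comment> \<open>Between -\<pi>/2 and 3\<pi>/2 the sine is nonnegative only on [0, \<pi>]. A
    negative \<open>D x\<close> is shifted by 2\<pi> into the range between \<pi> and 2\<pi>, where
    the sine is negative.\<close>
  have "D x \<ge> 0"
    using sin_nonneg[of x] lower sin_lt_zero[of "D x + 2 * pi"] sin_periodic[of "D x"] pi_gt_zero
    by linarith
  moreover have "D x \<le> pi"
    using sin_nonneg[of x] upper sin_lt_zero[of "D x"] pi_gt_zero
    by linarith
  ultimately show ?thesis
    by (simp add: D_def)
qed

text \<open>The bounds 0 and \<pi> on the angle difference survive the limit along the tangential
  path to \<open>x\<close>; dividing by \<pi> leaves the difference of the counts.\<close>

lemma arg_le_zeros_above:
  assumes "arg_le f g" "standard f" "standard g"
  shows "zeros_above x f \<le> zeros_above x g \<and> zeros_above x g \<le> Suc (zeros_above x f)"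
proof -
  have lim: "((\<lambda>t. total_angle (x + 1 / t) (1 / t\<^sup>2) g - total_angle (x + 1 / t) (1 / t\<^sup>2) f)
      \<longlongrightarrow> pi * real (zeros_above x g) - pi * real (zeros_above x f)) at_top"
    by (intro tendsto_diff total_angle_boundary)
  have ev: "eventually (\<lambda>t. total_angle (x + 1 / t) (1 / t\<^sup>2) g -
      total_angle (x + 1 / t) (1 / t\<^sup>2) f \<in> {0..pi}) at_top"
    using eventually_gt_at_top[of 0]
    by eventually_elim (rule arg_le_total_angle[OF assms], simp)
  have "pi * real (zeros_above x g) - pi * real (zeros_above x f) \<in> {0..pi}"
    by (rule Lim_in_closed_set[OF _ ev _ lim]) auto
  then have "pi * real (zeros_above x f) \<le> pi * real (zeros_above x g)"
      "pi * real (zeros_above x g) \<le> pi * real (Suc (zeros_above x f))"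
    by (auto simp: algebra_simps)
  then show ?thesis
    by (simp only: mult_le_cancel_left_pos[OF pi_gt_zero] of_nat_le_iff)
qed

text \<open>The entries above \<open>x\<close> form a final segment, and entry \<open>i\<close> is
  at most \<open>x\<close> exactly when it lies before that segment. The sum on the right avoids
  truncated subtraction.\<close>

lemma sorted_nth_le_iff:
  fixes xs :: "real list"
  assumes "sorted xs" "i < length xs"
  shows "xs ! i \<le> x \<longleftrightarrow> length (filter (\<lambda>a. x < a) xs) + i < length xs"
  using assms
proof (induction xs arbitrary: i)
  case (Cons a xs)
  show ?case
  proof (cases "x < a")
    case True
    then have "filter (\<lambda>a. x < a) xs = xs"
      using Cons.prems by (auto simp: filter_id_conv)
    moreover have "x < (a # xs) ! i"
      using True Cons.prems(2) sorted_nth_mono[OF Cons.prems(1), of 0 i] by auto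
    ultimately show ?thesis
      using True by auto
  next
    case False
    have "length (filter (\<lambda>a. x < a) xs) \<le> length xs"
      by simp
    then show ?thesis
      using False Cons by (cases i) (auto simp: less_Suc_eq_le)
  qed
qed simp

lemma zeros_nth_le_iff:
  assumes "standard p" "i < degree p"
  shows "zeros p ! i \<le> x \<longleftrightarrow> zeros_above x p + i < degree p"
proof -
  have "mset (zeros p) = proots p"
    by (simp add: zeros_def)
  then have "zeros_above x p = length (filter (\<lambda>a. x < a) (zeros p))"
      "length (zeros p) = size (proots p)"
    unfolding zeros_above_def by (metis mset_filter size_mset, metis size_mset)
  moreover have "size (proots p) = degree p"
    using assms(1) real_rooted_factor by (simp add: standard_def)
  moreover have "sorted (zeros p)"
    by (simp add: zeros_def)
  ultimately show ?thesis
    using sorted_nth_le_iff[of "zeros p" i x] assms(2) by simp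
qed

lemma zeros_above_degree:
  assumes "standard p"
  shows "eventually (\<lambda>x. zeros_above x p = degree p) at_bot"
proof -
  have "eventually (\<lambda>x. \<forall>a\<in>set_mset (proots p). x < a) at_bot"
    by (intro eventually_ball_finite) (auto intro: eventually_gt_at_bot)
  then show ?thesis
  proof eventually_elim
    case (elim x)
    then have "filter_mset (\<lambda>a. x < a) (proots p) = proots p"
      by (auto simp: filter_mset_eq_conv)
    then show ?case
      using assms real_rooted_factor[of p] by (simp add: zeros_above_def standard_def)
  qed
qed

text \<open>Counts at a point below all zeros compare the degrees. Each inequality between zeros is
  then tested at its own right-hand side: there the count for one polynomial is bounded, and
  \<open>above\<close> carries the bound to the other.\<close>

lemma arg_le_imp_il_le:
  assumes "arg_le f g" "standard f" "standard g"
  shows "f \<lless> g"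
proof -
  note above = arg_le_zeros_above[OF assms]
  note iff = zeros_nth_le_iff[OF assms(2)] zeros_nth_le_iff[OF assms(3)]
  have "eventually (\<lambda>x. zeros_above x f = degree f \<and> zeros_above x g = degree g) at_bot"
    by (intro eventually_conj zeros_above_degree assms)
  then obtain x where "zeros_above x f = degree f" "zeros_above x g = degree g"
    using eventually_happens[of _ "at_bot :: real filter"] by (auto simp: trivial_limit_at_bot_linorder)
  then consider "degree g = degree f" | "degree g = Suc (degree f)"
    using above[of x] by linarith
  then show ?thesis
  proof cases
    case 1
    have "zeros f ! i \<le> zeros g ! i" if "i < degree f" for i
      using iff(1)[of i "zeros g ! i"] iff(2)[of i "zeros g ! i"] above[of "zeros g ! i"] that 1
      by auto
    moreover have "zeros g ! i \<le> zeros f ! Suc i" if "Suc i < degree f" for i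
      using iff(1)[of "Suc i" "zeros f ! Suc i"] iff(2)[of i "zeros f ! Suc i"]
        above[of "zeros f ! Suc i"] that 1
      by auto
    ultimately have "alternates_left f g"
      using assms 1 by (simp add: alternates_left_def)
    then show ?thesis
      by (simp add: il_le_def)
  next
    case 2
    have "zeros g ! i \<le> zeros f ! i" if "i < degree f" for i
      using iff(1)[of i "zeros f ! i"] iff(2)[of i "zeros f ! i"] above[of "zeros f ! i"] that 2
      by auto
    moreover have "zeros f ! i \<le> zeros g ! Suc i" if "i < degree f" for i
      using iff(1)[of i "zeros g ! Suc i"] iff(2)[of "Suc i" "zeros g ! Suc i"]
        above[of "zeros g ! Suc i"] that 2
      by auto
    ultimately have "interlaces f g"
      using assms 2 by (simp add: interlaces_def)
    then show ?thesis
      by (simp add: il_le_def)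
  qed
qed

section \<open>The recurrence\<close>

definition words_ending :: "nat \<Rightarrow> nat \<Rightarrow> enat \<Rightarrow> enat list set" where
  "words_ending d n j = {w \<in> relaxed_words d n. w \<noteq> [] \<and> last w = j}"

definition preds :: "nat \<Rightarrow> enat \<Rightarrow> enat set" where
  "preds d j = {k \<in> letters d. k \<noteq> \<infinity> \<longrightarrow> k + 1 \<le> j}"

lemma finite_letters: "finite (letters d)"
  by (simp add: letters_def)

lemma finite_words_ending: "finite (words_ending d n j)"
  by (rule finite_subset[OF _ finite_lists_length_eq[OF finite_letters, of d n]])
    (auto simp: words_ending_def relaxed_words_def)

lemma words_ending_1:
  assumes "j \<in> letters d"
  shows "words_ending d 1 j = {[j]}"
  using assms by (auto simp: words_ending_def relaxed_words_def length_Suc_conv)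

text \<open>Appending \<open>j\<close> to a nonempty word creates exactly one new adjacent pair,
  \<open>last v\<close> and \<open>j\<close>.\<close>

lemma relaxed_words_snoc:
  assumes "v \<noteq> []"
  shows "v @ [j] \<in> relaxed_words d (Suc n) \<longleftrightarrow>
    v \<in> relaxed_words d n \<and> j \<in> letters d \<and> last v \<in> preds d j"
proof (cases "length v = n")
  case True
  then obtain m where m: "n = Suc m"
    using assms by (cases n) auto
  have "(\<forall>i. Suc i < Suc n \<longrightarrow> (v @ [j]) ! i \<noteq> \<infinity> \<longrightarrow> (v @ [j]) ! Suc i \<ge> (v @ [j]) ! i + 1) \<longleftrightarrow>
      (\<forall>i. Suc i < n \<longrightarrow> v ! i \<noteq> \<infinity> \<longrightarrow> v ! Suc i \<ge> v ! i + 1) \<and> (last v \<noteq> \<infinity> \<longrightarrow> last v + 1 \<le> j)"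
    using True assms unfolding m
    by (auto simp: nth_append last_conv_nth less_Suc_eq)
  moreover have "last v \<in> letters d" if "set v \<subseteq> letters d"
    using that assms by auto
  ultimately show ?thesis
    using True by (auto simp: relaxed_words_def preds_def)
qed (auto simp: relaxed_words_def)

lemma words_ending_Suc:
  assumes "j \<in> letters d" "n \<ge> 1"
  shows "words_ending d (Suc n) j = (\<lambda>v. v @ [j]) ` (\<Union>k\<in>preds d j. words_ending d n k)"
proof (intro equalityI subsetI)
  fix w
  assume w: "w \<in> words_ending d (Suc n) j"
  then have "w = butlast w @ [j]"
    by (metis (mono_tags, lifting) append_butlast_last_id mem_Collect_eq words_ending_def)
  moreover have "length w = Suc n"
    using w by (auto simp: words_ending_def relaxed_words_def)
  then have "butlast w \<noteq> []"
    using assms(2) by (simp flip: length_greater_0_conv)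
  ultimately have "butlast w \<in> words_ending d n (last (butlast w))" "last (butlast w) \<in> preds d j"
    using w relaxed_words_snoc[of "butlast w" j d n] by (auto simp: words_ending_def)
  then show "w \<in> (\<lambda>v. v @ [j]) ` (\<Union>k\<in>preds d j. words_ending d n k)"
    using \<open>w = butlast w @ [j]\<close> by blast
next
  fix w
  assume "w \<in> (\<lambda>v. v @ [j]) ` (\<Union>k\<in>preds d j. words_ending d n k)"
  then show "w \<in> words_ending d (Suc n) j"
    using assms(1) relaxed_words_snoc by (auto simp: words_ending_def)
qed

lemma Q_ref_1:
  assumes "j \<in> letters d"
  shows "Q_ref d 1 j = (if j = \<infinity> then 1 else [:0, 1:])"
  using words_ending_1[OF assms]
  by (simp add: Q_ref_def bigtiles_def monom_altdef flip: words_ending_def)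

text \<open>Words are grouped by their last letter but one; the appended letter contributes a factor
  \<open>[:0, 1:]\<close> exactly when it is an integer.\<close>

lemma Q_ref_Suc:
  assumes "j \<in> letters d" "n \<ge> 1"
  shows "Q_ref d (Suc n) j = (if j = \<infinity> then 1 else [:0, 1:]) * (\<Sum>k\<in>preds d j. Q_ref d n k)"
proof -
  have fin: "finite (preds d j)"
    by (simp add: preds_def finite_letters)
  have big: "monom 1 (bigtiles (v @ [j])) =
      (if j = \<infinity> then 1 else [:0, 1:]) * (monom 1 (bigtiles v) :: real poly)" for v
    by (simp add: bigtiles_def monom_Suc)
  have "Q_ref d (Suc n) j = (\<Sum>v\<in>(\<Union>k\<in>preds d j. words_ending d n k). monom 1 (bigtiles (v @ [j])))"
    unfolding Q_ref_def words_ending_def[symmetric] words_ending_Suc[OF assms]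
    by (subst sum.reindex) (auto simp: inj_on_def)
  also have "\<dots> = (\<Sum>k\<in>preds d j. \<Sum>v\<in>words_ending d n k. monom 1 (bigtiles (v @ [j])))"
    by (rule sum.UNION_disjoint) (auto simp: fin finite_words_ending, auto simp: words_ending_def)
  finally show ?thesis
    unfolding big sum_distrib_left Q_ref_def words_ending_def[symmetric] .
qed

text \<open>Index 0 stands for \<open>\<infinity>\<close>, as in the order of the sequence. The
  possible predecessors of any letter then form an initial segment of indices: all of them for
  \<open>\<infinity>\<close>, and 0 to \<open>i - 1\<close> for an integer \<open>i\<close>.\<close>

definition nth_letter :: "nat \<Rightarrow> enat" where
  "nth_letter i = (if i = 0 then \<infinity> else enat i)"

lemma nth_letter_eq_infinity_iff [simp]: "nth_letter i = \<infinity> \<longleftrightarrow> i = 0"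
  by (simp add: nth_letter_def)

lemma inj_nth_letter: "inj nth_letter"
  by (auto simp: inj_def nth_letter_def)

lemma letters_eq: "letters d = nth_letter ` {..<Suc d}"
proof -
  have "{..<Suc d} = insert 0 {1..d}" by auto
  then show ?thesis
    by (auto simp: letters_def nth_letter_def)
qed

lemma preds_nth_letter:
  assumes "i \<le> d"
  shows "preds d (nth_letter i) = nth_letter ` {..<(if i = 0 then Suc d else i)}"
  using assms
  by (auto simp: preds_def letters_eq nth_letter_def one_enat_def)

lemma Q_ref_nth_letter_Suc:
  assumes "i \<le> d" "n \<ge> 1"
  shows "Q_ref d (Suc n) (nth_letter i) =
    (if i = 0 then (\<Sum>k<Suc d. Q_ref d n (nth_letter k))
     else [:0, 1:] * (\<Sum>k<i. Q_ref d n (nth_letter k)))"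
proof -
  have "nth_letter i \<in> letters d"
    using assms by (auto simp: letters_eq)
  then show ?thesis
    using assms inj_on_subset[OF inj_nth_letter]
    by (auto simp: Q_ref_Suc preds_nth_letter sum.reindex)
qed

section \<open>Interlacing sequences\<close>

text \<open>
  The second conjunct takes over the role of the nonpositivity of the zeros in the induction.
\<close>

definition arg_chain :: "nat \<Rightarrow> (nat \<Rightarrow> real poly) \<Rightarrow> bool" where
  "arg_chain d f \<longleftrightarrow>
     (\<forall>i j. i \<le> j \<longrightarrow> j \<le> d \<longrightarrow> arg_le (f i) (f j) \<and> arg_le (f j) ([:0, 1:] * f i))"

text \<open>The shorter sum stays fixed while the longer one grows from it. Each added
  \<open>f j\<close> comes after every \<open>f k\<close> with \<open>k < i\<close> and before every
  \<open>[:0, 1:] * f k\<close>, so both relations persist by additivity.\<close>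

lemma arg_chain_partial_sums:
  assumes "arg_chain d f" "1 \<le> i" "i \<le> j" "j \<le> Suc d"
  shows "arg_le (\<Sum>k<i. f k) (\<Sum>k<j. f k) \<and> arg_le (\<Sum>k<j. f k) ([:0, 1:] * (\<Sum>k<i. f k))"
  using assms(3,4)
proof (induction j rule: dec_induct)
  case base
  \<comment> \<open>Comparison with the last summand excludes zeros of the sum in the upper
    half-plane.\<close>
  have "arg_le (\<Sum>k<i. f k) (f (i - 1))"
    using assms by (intro arg_le_sum_left) (auto simp: arg_chain_def lessThan_empty_iff)
  then have "real_rooted (\<Sum>k<i. f k)"
    by (rule arg_le_real_rooted)
  then show ?case
    by (simp add: arg_le_refl arg_le_X_mult del: mult_pCons_left)
next
  case (step j)
  have "arg_le (\<Sum>k<i. f k) (f j)"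
    using assms step by (intro arg_le_sum_left) (auto simp: arg_chain_def lessThan_empty_iff)
  moreover have "arg_le (f j) ([:0, 1:] * (\<Sum>k<i. f k))"
  proof -
    have "(\<Sum>k<i. cpoly ([:0, 1:] * f k) z * cnj (cpoly (f j) z)) \<in> half_cone" if "Im z > 0" for z
      using assms step that
      by (intro half_cone_sum) (auto simp: arg_chain_def arg_le_def lessThan_empty_iff
          simp del: mult_pCons_left cpoly_mult)
    then show ?thesis
      by (simp add: arg_le_def cpoly_sum sum_distrib_left sum_distrib_right mult.assoc
          del: mult_pCons_left)
  qed
  ultimately show ?case
    using step by (simp add: arg_le_add_left arg_le_add_right del: mult_pCons_left)
qed

lemma arg_chain_Q_ref:
  assumes "n \<ge> 1"
  shows "arg_chain d (\<lambda>i. Q_ref d n (nth_letter i))"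
  using assms
proof (induction n rule: dec_induct)
  case base
  have rr: "real_rooted 1" "real_rooted [:0, 1:]"
    by (auto simp: real_rooted_iff_upper one_pCons)
  have Q1: "Q_ref d 1 (nth_letter i) = (if i = 0 then 1 else [:0, 1:])" if "i \<le> d" for i
    using that by (subst Q_ref_1) (auto simp: letters_eq)
  have "arg_le 1 [:0, 1:]"
    using arg_le_X_mult[OF rr(1)] by simp
  then show ?case
    using rr arg_le_refl[OF rr(1)] arg_le_refl[OF rr(2)] arg_le_X_mult[OF rr(2)]
    by (auto simp: arg_chain_def Q1 one_pCons simp del: One_nat_def)
next
  case (step n)
  define f where "f i = Q_ref d n (nth_letter i)" for i
  define S where "S i = (\<Sum>k<i. f k)" for i
  have Q: "Q_ref d (Suc n) (nth_letter i) = (if i = 0 then S (Suc d) else [:0, 1:] * S i)"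
    if "i \<le> d" for i
    using Q_ref_nth_letter_Suc[OF that step(1)] by (simp add: S_def f_def)
  have chain: "arg_le (S i) (S j)" "arg_le (S j) ([:0, 1:] * S i)"
    if "1 \<le> i" "i \<le> j" "j \<le> Suc d" for i j
    using arg_chain_partial_sums[OF _ that] step by (auto simp: S_def f_def)
  show ?case
    unfolding arg_chain_def
  proof (intro allI impI)
    fix i j
    assume ij: "i \<le> j" "j \<le> d"
    then have "i \<le> d" by simp
    note Q' = Q[OF this] Q[OF ij(2)]
    consider "j = 0" | "i = 0" "j > 0" | "i > 0"
      by auto
    then show "arg_le (Q_ref d (Suc n) (nth_letter i)) (Q_ref d (Suc n) (nth_letter j)) \<and>
        arg_le (Q_ref d (Suc n) (nth_letter j)) ([:0, 1:] * Q_ref d (Suc n) (nth_letter i))"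
    proof cases
      case 1
      then show ?thesis
        using ij Q' chain[of "Suc d" "Suc d"] by simp
    next
      \<comment> \<open>The two relations in \<open>chain\<close> exchange roles: the second puts
        \<open>S (Suc d)\<close> before \<open>[:0, 1:] * S j\<close>, and the first, multiplied by
        \<open>[:0, 1:]\<close>, gives the other conjunct.\<close>
      case 2
      then show ?thesis
        using ij Q' chain(1)[of j "Suc d"] chain(2)[of j "Suc d"]
        by (simp add: arg_le_X_mult_both del: mult_pCons_left)
    next
      case 3
      then show ?thesis
        using ij Q' chain[of i j] by (simp add: arg_le_X_mult_both del: mult_pCons_left)
    qed
  qed
qed

section \<open>Positive leading coefficients and conclusion\<close>

lemma coeff_Q_ref_nonneg: "coeff (Q_ref d n j) k \<ge> 0"
  by (auto simp: Q_ref_def coeff_sum intro!: sum_nonneg)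

theorem theorem3p10:
  fixes d n :: nat
  assumes "d \<ge> 1" and "n \<ge> 1"
  shows "interlacing_seq (map (Q_ref d n) (\<infinity> # map enat [1..<Suc d]))
       \<and> Q d n = Q_ref d n \<infinity>
       \<and> real_rooted (Q d n)
       \<and> real_rooted (Q_ref d (n + 1) \<infinity>)"
proof -
  have std: "standard (Q_ref d m (nth_letter i))" if "m \<ge> 1" "i \<le> d" for m i
  proof -
    have le: "arg_le (Q_ref d m (nth_letter i)) (Q_ref d m (nth_letter i))"
      using arg_chain_Q_ref[OF that(1), of d] that(2) by (simp add: arg_chain_def)
    have "Q_ref d m (nth_letter i) \<noteq> 0"
      using arg_le_nonzero[OF le, of \<i>] by auto
    then have "lead_coeff (Q_ref d m (nth_letter i)) > 0"
      using coeff_Q_ref_nonneg[of d m "nth_letter i"]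
      by (metis leading_coeff_0_iff order_le_less)
    then show ?thesis
      using arg_le_real_rooted[OF le] by (simp add: standard_def)
  qed
  have seq: "map (Q_ref d n) (\<infinity> # map enat [1..<Suc d]) =
      map (\<lambda>i. Q_ref d n (nth_letter i)) [0..<Suc d]"
    by (auto simp: upt_conv_Cons nth_letter_def simp del: upt_Suc)
  have "interlacing_seq (map (Q_ref d n) (\<infinity> # map enat [1..<Suc d]))"
    unfolding seq interlacing_seq_def
    using std[OF assms(2)] arg_chain_Q_ref[OF assms(2), of d]
    by (auto simp: standard_def arg_chain_def simp del: upt_Suc intro!: arg_le_imp_il_le)
  moreover have "Q d n = Q_ref d n \<infinity>"
    by (simp add: Q_def Q_ref_def anchor_words_def)
  \<comment> \<open>Kept general in \<open>m\<close> because it is needed both at \<open>n\<close>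
    and at \<open>n + 1\<close>.\<close>
  moreover have "real_rooted (Q_ref d m \<infinity>)" if "m \<ge> 1" for m
    using std[OF that, of 0] by (simp add: standard_def nth_letter_def)
  ultimately show ?thesis
    using assms by simp
qed

end
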